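(* For an $\aleph_0$-space $X$ the following conditions are equivalent: (1) $C_k(X)$ is metrizable; (2) $C_k(X)$ contains no strong $\mathrm{Fin}^\omega$-fan; (3) $X$ is hemicompact.
   Context: $C_k(X)$ is the space of continuous real-valued functions on $X$ with the compact-open topology. "Regular" includes $T_1$. A family $\mathcal N$ of subsets of $X$ is a $k$-network if for each open $U\subset X$ and compact $K\subset U$ there is a finite $\mathcal F\subset\mathcal N$ with $K\subset\bigcup\mathcal F\subset U$. An $\aleph_0$-space is a regular space with a countable $k$-network. $X$ is hemicompact if it has a countable cover $\mathcal K$ by compact subsets such that each compact subset of $X$ is contained in some $K\in\mathcal K$. For a topological space $Y$, a family $(F_n)_{n\in\omega}$ of subsets of $Y$ is locally finite if each point of $Y$ has a neighborhood meeting $F_n$ for only finitely many $n$; it is compact-finite if each compact subset of $Y$ meets $F_n$ for only finitely many $n$. A set $U\subset Y$ is $\mathbb R$-open if for each $y\in U$ there is a continuous $f:Y\to[0,1]$ with $f(y)=1$ and $f(Y\setminus U)\subset\{0\}$. A $\mathrm{Fin}^\omega$-fan in $Y$ is a family $(F_n)_{n\in\omega}$ of finite subsets of $Y$ that is compact-finite but not locally finite; it is strong if each $F_n$ has an $\mathbb R$-open neighborhood $U_n\supset F_n$ such that $(U_n)_{n\in\omega}$ is compact-finite. *)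

theory Defs
  imports "HOL-Analysis.Analysis"
begin

definition k_network :: "'a topology \<Rightarrow> 'a set set \<Rightarrow> bool" where
  "k_network X \<N> \<longleftrightarrow>
     \<N> \<subseteq> Pow (topspace X) \<and>
     (\<forall>U K. openin X U \<and> compactin X K \<and> K \<subseteq> U \<longrightarrow>
        (\<exists>\<F>. finite \<F> \<and> \<F> \<subseteq> \<N> \<and> K \<subseteq> \<Union>\<F> \<and> \<Union>\<F> \<subseteq> U))"

(* regular_space of the library does not include the T1 axiom. *)
definition aleph0_space :: "'a topology \<Rightarrow> bool" where
  "aleph0_space X \<longleftrightarrow>
     regular_space X \<and> t1_space X \<and> (\<exists>\<N>. countable \<N> \<and> k_network X \<N>)"

definition hemicompact_space :: "'a topology \<Rightarrow> bool" where
  "hemicompact_space X \<longleftrightarrow>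
     (\<exists>\<K>. countable \<K> \<and> (\<forall>K\<in>\<K>. compactin X K) \<and> \<Union>\<K> = topspace X \<and>
        (\<forall>C. compactin X C \<longrightarrow> (\<exists>K\<in>\<K>. C \<subseteq> K)))"

(* Continuous real-valued functions on the space X. Since X is carried by a subset of its type,
   functions are required to be extensional (undefined outside topspace X), so that each
   continuous function on X is represented exactly once. *)
definition cont_real_functions :: "'a topology \<Rightarrow> ('a \<Rightarrow> real) set" where
  "cont_real_functions X = {f \<in> extensional (topspace X). continuous_map X euclideanreal f}"

(* The space C_k(X): the compact-open topology, given by its standard subbase.
   Taking K = {} shows that its underlying set is cont_real_functions X. *)
definition Ck :: "'a topology \<Rightarrow> ('a \<Rightarrow> real) topology" where
  "Ck X = topology_generated_by
     {{f \<in> cont_real_functions X. f ` K \<subseteq> U} | K U. compactin X K \<and> open U}"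

lemma topspace_Ck: "topspace (Ck X) = cont_real_functions X"
proof -
  have "cont_real_functions X \<in>
      {{f \<in> cont_real_functions X. f ` K \<subseteq> U} | K U. compactin X K \<and> open U}"
    by (rule CollectI, rule exI[of _ "{}"], rule exI[of _ UNIV]) auto
  then show ?thesis
    unfolding Ck_def topology_generated_by_topspace by blast
qed

(* Local and compact finiteness of families indexed by nat: the indices n are counted, not the
   sets F n, unlike in locally_finite_in, which is about sets of sets. *)
definition locally_finite_family :: "'b topology \<Rightarrow> (nat \<Rightarrow> 'b set) \<Rightarrow> bool" where
  "locally_finite_family Y F \<longleftrightarrow>
     (\<forall>y\<in>topspace Y. \<exists>V. openin Y V \<and> y \<in> V \<and> finite {n. F n \<inter> V \<noteq> {}})"

definition compact_finite_family :: "'b topology \<Rightarrow> (nat \<Rightarrow> 'b set) \<Rightarrow> bool" where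
  "compact_finite_family Y F \<longleftrightarrow>
     (\<forall>K. compactin Y K \<longrightarrow> finite {n. F n \<inter> K \<noteq> {}})"

definition R_open :: "'b topology \<Rightarrow> 'b set \<Rightarrow> bool" where
  "R_open Y U \<longleftrightarrow>
     U \<subseteq> topspace Y \<and>
     (\<forall>y\<in>U. \<exists>f. continuous_map Y (top_of_set {0..1::real}) f \<and>
        f y = 1 \<and> f ` (topspace Y - U) \<subseteq> {0})"

definition Fin_fan :: "'b topology \<Rightarrow> (nat \<Rightarrow> 'b set) \<Rightarrow> bool" where
  "Fin_fan Y F \<longleftrightarrow>
     (\<forall>n. finite (F n) \<and> F n \<subseteq> topspace Y) \<and>
     compact_finite_family Y F \<and> \<not> locally_finite_family Y F"

definition strong_Fin_fan :: "'b topology \<Rightarrow> (nat \<Rightarrow> 'b set) \<Rightarrow> bool" where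
  "strong_Fin_fan Y F \<longleftrightarrow>
     Fin_fan Y F \<and>
     (\<exists>U. (\<forall>n. R_open Y (U n) \<and> F n \<subseteq> U n) \<and> compact_finite_family Y U)"

end

theory Submission
  imports Defs
begin

text \<open>
  In a metrizable space a compact-finite family is locally finite, since a convergent sequence
  meeting infinitely many members is compact. For hemicompact \<open>X\<close> with cofinal compact sets
  \<open>k n\<close>, the supremum of \<open>min (1/(n+1)) \<bar>f x - g x\<bar>\<close> over \<open>x \<in> k n\<close> metrizes \<open>C\<^sub>k(X)\<close>.

  Suppose \<open>X\<close> is not hemicompact. Let \<open>(N i)\<close> enumerate a countable \<open>k\<close>-network closed under
  intersections, and call \<open>i\<close> bad if no compact set contains \<open>N i\<close>. Some compact \<open>K\<^sub>0\<close> lies in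
  \<open>N i\<close> only for bad \<open>i\<close>. A compact \<open>C \<subseteq> C\<^sub>k(X)\<close> is uniformly bounded on some \<open>N i \<supseteq> K\<^sub>0\<close>, because
  otherwise points witnessing unboundedness would converge to \<open>K\<^sub>0\<close> and form a compact set with it.
  So if \<open>G a b\<close> consists of the \<open>f\<close> that exceed \<open>a\<close> somewhere on each bad \<open>N i\<close>, \<open>i \<le> a\<close>, and
  exceed \<open>b\<close> at \<open>x a\<close>, then \<open>G\<close> is compact-finite: the first condition bounds \<open>a\<close>, the second
  bounds \<open>b\<close> for each \<open>a\<close>. If moreover no compact set contains almost all \<open>x a\<close>, then for every
  compact \<open>K\<close> there are arbitrarily large \<open>a\<close> with \<open>x a \<notin> K\<close>, and Urysohn's lemma gives some \<open>b\<close>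
  and a function in \<open>G a b\<close> vanishing on \<open>N b \<supseteq> K\<close>. One such function for each pair \<open>(a, b)\<close> that
  admits one is a fan accumulating at \<open>0\<close>.
\<close>

section \<open>Convergent sequences and compact-finite families\<close>

text \<open>A finite subcover of \<open>K\<close> has an open union, which absorbs all but finitely
  many \<open>x n\<close>. Convergence is to the set \<open>K\<close> rather than to a point of it,
  so that the lemma serves metric limits and arbitrary compact sets alike.\<close>

lemma compactin_Un_range:
  assumes K: "compactin X K" and x: "\<And>n::nat. x n \<in> topspace X"
    and ev: "\<And>U. openin X U \<Longrightarrow> K \<subseteq> U \<Longrightarrow> eventually (\<lambda>n. x n \<in> U) sequentially"
  shows "compactin X (K \<union> range x)"
  unfolding compactin_def
proof (intro conjI allI impI)
  show "K \<union> range x \<subseteq> topspace X"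
    using compactin_subset_topspace[OF K] x by blast
next
  fix \<U> assume \<U>: "(\<forall>U\<in>\<U>. openin X U) \<and> K \<union> range x \<subseteq> \<Union>\<U>"
  then obtain \<F> where \<F>: "finite \<F>" "\<F> \<subseteq> \<U>" "K \<subseteq> \<Union>\<F>"
    using K unfolding compactin_def by (meson le_sup_iff)
  then have "openin X (\<Union>\<F>)"
    using \<U> by blast
  from ev[OF this \<F>(3)] obtain m where m: "\<And>n. n \<ge> m \<Longrightarrow> x n \<in> \<Union>\<F>"
    unfolding eventually_sequentially by metis
  have "\<forall>n. \<exists>U\<in>\<U>. x n \<in> U"
    using \<U> by blast
  then obtain u where u: "\<And>n. u n \<in> \<U>" "\<And>n. x n \<in> u n"
    by metis
  have "K \<union> range x \<subseteq> \<Union>(\<F> \<union> u ` {..<m})"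
  proof
    fix y assume "y \<in> K \<union> range x"
    then consider "y \<in> K" | n where "y = x n" by blast
    then show "y \<in> \<Union>(\<F> \<union> u ` {..<m})"
    proof cases
      case 2
      then show ?thesis
        using m[of n] u(2)[of n] by (cases "n < m") auto
    qed (use \<F> in blast)
  qed
  moreover have "finite (\<F> \<union> u ` {..<m})" "\<F> \<union> u ` {..<m} \<subseteq> \<U>"
    using \<F> u by auto
  ultimately show "\<exists>\<F>. finite \<F> \<and> \<F> \<subseteq> \<U> \<and> K \<union> range x \<subseteq> \<Union>\<F>"
    by blast
qed

lemma metrizable_compact_finite_imp_locally_finite:
  assumes "metrizable_space Y" and cf: "compact_finite_family Y F"
  shows "locally_finite_family Y F"
proof -
  obtain M d where "Metric_space M d" and Y: "Y = Metric_space.mtopology M d"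
    using assms unfolding metrizable_space_def by blast
  then interpret Metric_space M d by blast
  show ?thesis
    unfolding locally_finite_family_def
  proof (rule ballI, rule ccontr)
    fix y assume y: "y \<in> topspace Y"
      and nf: "\<nexists>V. openin Y V \<and> y \<in> V \<and> finite {n. F n \<inter> V \<noteq> {}}"
    \<comment> \<open>The bound \<open>n \<ge> k\<close> makes the indices unbounded, so the compact
      set built from the points \<open>z k\<close> meets infinitely many members even if indices
      repeat.\<close>
    have "\<exists>n z. n \<ge> k \<and> z \<in> F n \<inter> mball y (1 / Suc k)" for k
    proof -
      have "infinite {n. F n \<inter> mball y (1 / Suc k) \<noteq> {}}"
        using nf y Y by auto
      then obtain n where "n \<ge> k" "F n \<inter> mball y (1 / Suc k) \<noteq> {}"
        unfolding infinite_nat_iff_unbounded_le by blast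
      then show ?thesis by blast
    qed
    then obtain n z where n: "\<And>k. n k \<ge> k" and z: "\<And>k. z k \<in> F (n k) \<inter> mball y (1 / Suc k)"
      by metis
    have "compactin Y ({y} \<union> range z)"
    proof (rule compactin_Un_range)
      show "compactin Y {y}" using y by simp
      show "z k \<in> topspace Y" for k using z[of k] Y by auto
    next
      fix U assume U: "openin Y U" "{y} \<subseteq> U"
      then obtain r where r: "r > 0" "mball y r \<subseteq> U"
        using Y openin_mtopology by auto
      obtain m where m: "inverse (real (Suc m)) < r"
        using reals_Archimedean r(1) by blast
      have "z k \<in> U" if "k \<ge> m" for k
      proof -
        have "1 / real (Suc k) \<le> inverse (real (Suc m))"
          using that by (simp add: field_simps)
        then have "z k \<in> mball y r"
          using z[of k] m by auto
        then show ?thesis using r by blast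
      qed
      then show "eventually (\<lambda>k. z k \<in> U) sequentially"
        unfolding eventually_sequentially by blast
    qed
    then have "finite {i. F i \<inter> ({y} \<union> range z) \<noteq> {}}"
      using cf unfolding compact_finite_family_def by blast
    moreover have "range n \<subseteq> {i. F i \<inter> ({y} \<union> range z) \<noteq> {}}"
      using z by fastforce
    ultimately have "finite (range n)"
      using finite_subset by blast
    then obtain b where "\<And>k. n k \<le> b"
      unfolding finite_nat_set_iff_bounded_le by blast
    then show False
      using n[of "Suc b"] by (meson Suc_n_not_le_n le_trans)
  qed
qed

section \<open>The compact-open topology\<close>

lemma openin_Ck_subbase:
  assumes "compactin X K" "open U"
  shows "openin (Ck X) {f \<in> cont_real_functions X. f ` K \<subseteq> U}"
  unfolding Ck_def using assms by (intro topology_generated_by_Basis) blast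

lemma continuous_map_Ck_eval:
  assumes "x \<in> topspace X"
  shows "continuous_map (Ck X) euclideanreal (\<lambda>f. f x)"
  unfolding continuous_map topspace_Ck
proof (intro conjI allI impI)
  fix U :: "real set" assume "openin euclideanreal U"
  then show "openin (Ck X) {f \<in> cont_real_functions X. f x \<in> U}"
    using openin_Ck_subbase[of X "{x}" U] assms by simp
qed simp

lemma restrict_in_cont_real_functions:
  "continuous_map X euclideanreal f \<Longrightarrow> restrict f (topspace X) \<in> cont_real_functions X"
  unfolding cont_real_functions_def
  by (intro CollectI conjI restrict_extensional, erule continuous_map_eq) simp

text \<open>A subbasic set restricts functions on one compact set only. Finite intersections unite
  these compact sets, and for a union one member suffices.\<close>

lemma Ck_nhd_of_zero:
  assumes "openin (Ck X) V" "restrict (\<lambda>_. 0) (topspace X) \<in> V"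
  obtains K where "compactin X K"
    "\<And>g. g \<in> cont_real_functions X \<Longrightarrow> (\<And>x. x \<in> K \<Longrightarrow> g x = 0) \<Longrightarrow> g \<in> V"
proof -
  let ?z = "restrict (\<lambda>_. 0::real) (topspace X)"
  let ?P = "\<lambda>V. ?z \<in> V \<longrightarrow> (\<exists>K. compactin X K \<and>
    (\<forall>g\<in>cont_real_functions X. (\<forall>x\<in>K. g x = 0) \<longrightarrow> g \<in> V))"
  have "generate_topology_on
     {{f \<in> cont_real_functions X. f ` K \<subseteq> U} | K U. compactin X K \<and> open U} V"
    using assms(1) unfolding Ck_def openin_topology_generated_by_iff .
  then have "?P V"
  proof induction
    case (Int a b)
    show ?case
    proof
      assume "?z \<in> a \<inter> b"
      then obtain K L where "compactin X K" "compactin X L"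
        "\<forall>g\<in>cont_real_functions X. (\<forall>x\<in>K. g x = 0) \<longrightarrow> g \<in> a"
        "\<forall>g\<in>cont_real_functions X. (\<forall>x\<in>L. g x = 0) \<longrightarrow> g \<in> b"
        using Int.IH by blast
      then have "compactin X (K \<union> L) \<and>
          (\<forall>g\<in>cont_real_functions X. (\<forall>x\<in>K \<union> L. g x = 0) \<longrightarrow> g \<in> a \<inter> b)"
        using compactin_Un by blast
      then show "\<exists>K. compactin X K \<and>
          (\<forall>g\<in>cont_real_functions X. (\<forall>x\<in>K. g x = 0) \<longrightarrow> g \<in> a \<inter> b)"
        by blast
    qed
  next
    case (UN \<K>)
    show ?case
    proof
      assume "?z \<in> \<Union>\<K>"
      then obtain W where "W \<in> \<K>" "?z \<in> W" by blast
      moreover from this obtain K where "compactin X K"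
          "\<forall>g\<in>cont_real_functions X. (\<forall>x\<in>K. g x = 0) \<longrightarrow> g \<in> W"
        using UN.IH by blast
      ultimately show "\<exists>K. compactin X K \<and>
          (\<forall>g\<in>cont_real_functions X. (\<forall>x\<in>K. g x = 0) \<longrightarrow> g \<in> \<Union>\<K>)"
        by (intro exI[of _ K]) blast
    qed
  next
    case (Basis s)
    then obtain K U where KU: "compactin X K" "open U"
      "s = {f \<in> cont_real_functions X. f ` K \<subseteq> U}" by blast
    show ?case
    proof
      assume "?z \<in> s"
      then have "?z ` K \<subseteq> U" using KU by blast
      \<comment> \<open>The premise \<open>x \<in> K\<close> matters: for empty \<open>K\<close>
        nothing forces \<open>0 \<in> U\<close>.\<close>
      then have "0 \<in> U" if "x \<in> K" for x
        using that compactin_subset_topspace[OF KU(1)] by force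
      then have "\<forall>g\<in>cont_real_functions X. (\<forall>x\<in>K. g x = 0) \<longrightarrow> g \<in> s"
        using KU by auto
      then show "\<exists>K. compactin X K \<and>
          (\<forall>g\<in>cont_real_functions X. (\<forall>x\<in>K. g x = 0) \<longrightarrow> g \<in> s)"
        using KU by blast
    qed
  qed simp
  then show ?thesis using assms(2) that by blast
qed

lemma cont_real_functions_bounded_on_compactin:
  assumes "f \<in> cont_real_functions X" "compactin X K"
  shows "\<exists>n::nat. \<forall>x\<in>K. \<bar>f x\<bar> < n"
proof -
  have "compactin euclideanreal (f ` K)"
    using image_compactin[OF assms(2)] assms(1) unfolding cont_real_functions_def by blast
  then have "bounded (f ` K)" by (simp add: compact_imp_bounded)
  then obtain b where b: "\<forall>x\<in>K. \<bar>f x\<bar> \<le> b"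
    unfolding bounded_iff by auto
  obtain n :: nat where "b < n" using reals_Archimedean2 by blast
  then show ?thesis using b by (meson le_less_trans)
qed

text \<open>The functions with values in (-n, n) on \<open>K\<close> form an open set. As each
  continuous function is bounded on \<open>K\<close>, these sets cover \<open>C\<close>, and
  finitely many suffice.\<close>

lemma compactin_Ck_uniformly_bounded:
  assumes C: "compactin (Ck X) C" and K: "compactin X K"
  obtains n :: nat where "\<And>f x. f \<in> C \<Longrightarrow> x \<in> K \<Longrightarrow> \<bar>f x\<bar> < n"
proof -
  define W where "W = (\<lambda>n::nat. {f \<in> cont_real_functions X. f ` K \<subseteq> {-real n<..<real n}})"
  have "\<forall>U \<in> range W. openin (Ck X) U"
    unfolding W_def using openin_Ck_subbase[OF K] by auto
  moreover have "C \<subseteq> \<Union>(range W)"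
  proof
    fix f assume "f \<in> C"
    then have f: "f \<in> cont_real_functions X"
      using compactin_subset_topspace[OF C] topspace_Ck by blast
    then obtain n :: nat where "\<forall>x\<in>K. \<bar>f x\<bar> < n"
      using cont_real_functions_bounded_on_compactin K by blast
    then have "f \<in> W n" using f unfolding W_def by force
    then show "f \<in> \<Union>(range W)" by blast
  qed
  ultimately have "\<exists>\<F>. finite \<F> \<and> \<F> \<subseteq> range W \<and> C \<subseteq> \<Union>\<F>"
    using C unfolding compactin_def by meson
  then obtain I where I: "finite I" "C \<subseteq> \<Union>(W ` I)"
    by (metis finite_subset_image)
  then obtain m where m: "\<And>n. n \<in> I \<Longrightarrow> n \<le> m"
    using I(1) unfolding finite_nat_set_iff_bounded_le by blast
  have "\<bar>f x\<bar> < m" if fx: "f \<in> C" "x \<in> K" for f x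
  proof -
    obtain n where "n \<in> I" "f \<in> W n" using I fx by blast
    then have "\<bar>f x\<bar> < n" "n \<le> m" using m fx unfolding W_def by force+
    then show ?thesis by linarith
  qed
  then show ?thesis using that by blast
qed

text \<open>Half of the classical fact that the compact-open topology is that of uniform convergence
  on compact sets: \<open>K\<close> is cut into finitely many compact pieces on which
  \<open>f\<close> varies little.\<close>

lemma Ck_uniform_nhd:
  assumes f: "f \<in> cont_real_functions X" and K: "compactin X K" and e: "e > 0"
  obtains V where "openin (Ck X) V" "f \<in> V" "\<And>g x. g \<in> V \<Longrightarrow> x \<in> K \<Longrightarrow> \<bar>f x - g x\<bar> < e"
proof -
  have cf: "continuous_map X euclideanreal f"
    using f by (simp add: cont_real_functions_def)
  have "compact (f ` K)"
    using image_compactin[OF K cf] by simp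
  then obtain T where T: "finite T" "f ` K \<subseteq> (\<Union>t\<in>T. ball t (e/3))"
    by (rule compactE_image[of _ "f ` K" "\<lambda>t. ball t (e/3)"]) (use e in auto)
  \<comment> \<open>Closed balls keep \<open>L t\<close> compact. The larger open balls of radius
    \<open>2*e/3\<close> below still contain the values of \<open>f\<close> on \<open>L t\<close>,
    and the radii \<open>e/3\<close> and \<open>2*e/3\<close> add up to \<open>e\<close>.\<close>
  define L where "L = (\<lambda>t. {x \<in> topspace X. f x \<in> cball t (e/3)} \<inter> K)"
  have L: "compactin X (L t)" for t
    unfolding L_def
    by (intro closed_Int_compactin closedin_continuous_map_preimage[OF cf] K) auto
  \<comment> \<open>For empty \<open>T\<close> the intersection alone would be the whole
    type.\<close>
  define V where "V = cont_real_functions X \<inter>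
    (\<Inter>t\<in>T. {g \<in> cont_real_functions X. g ` L t \<subseteq> ball t (2*e/3)})"
  show ?thesis
  proof
    have "openin (Ck X) (topspace (Ck X) \<inter>
        (\<Inter>t\<in>T. {g \<in> cont_real_functions X. g ` L t \<subseteq> ball t (2*e/3)}))"
      by (intro openin_Int_Inter) (use T openin_Ck_subbase[OF L] in auto)
    then show "openin (Ck X) V" unfolding V_def topspace_Ck .
    show "f \<in> V" unfolding V_def L_def using f e by auto
  next
    fix g x assume g: "g \<in> V" and x: "x \<in> K"
    then obtain t where t: "t \<in> T" "f x \<in> ball t (e/3)" using T by blast
    then have "x \<in> L t" unfolding L_def
      using x compactin_subset_topspace[OF K] by auto
    then have "g x \<in> ball t (2*e/3)" using g t unfolding V_def by blast
    then show "\<bar>f x - g x\<bar> < e"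
      using t by (simp add: dist_real_def abs_real_def split: if_splits)
  qed
qed

section \<open>Hemicompact spaces\<close>

lemma hemicompact_imp_metrizable_Ck:
  assumes "hemicompact_space X"
  shows "metrizable_space (Ck X)"
proof -
  obtain \<K> where \<K>: "countable \<K>" "\<forall>K\<in>\<K>. compactin X K" "\<Union>\<K> = topspace X"
     "\<forall>C. compactin X C \<longrightarrow> (\<exists>K\<in>\<K>. C \<subseteq> K)"
    using assms unfolding hemicompact_space_def by blast
  \<comment> \<open>Even for empty \<open>X\<close> some member must contain the compact set
    \<open>{}\<close>; hence \<open>\<K>\<close> can be listed as a sequence.\<close>
  have "\<K> \<noteq> {}" using \<K>(4) compactin_empty by blast
  then obtain k where k: "range k = \<K>" "\<And>n::nat. compactin X (k n)"
    using \<K>(1,2) by (metis range_from_nat_into rangeI)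
  define M where "M = cont_real_functions X"
  \<comment> \<open>The cap \<open>1 / Suc n\<close> makes the terms of large index uniformly small,
    so that a given radius involves only finitely many \<open>k n\<close>. Below the cap the term is
    the difference itself.\<close>
  define \<delta> where "\<delta> = (\<lambda>f g (n, x::'a). min (1 / Suc n) \<bar>f x - g x :: real\<bar>)"
  \<comment> \<open>The index \<open>None\<close> keeps the index set of the supremum nonempty when \<open>X\<close> is empty.\<close>
  define I where "I = insert None (Some ` (SIGMA n:UNIV. k n))"
  define \<delta>' where "\<delta>' = (\<lambda>f g p. case p of None \<Rightarrow> 0 | Some q \<Rightarrow> \<delta> f g q)"
  define d where "d = (\<lambda>f g. SUP p\<in>I. \<delta>' f g p)"
  have bound: "0 \<le> \<delta>' f g p" "\<delta>' f g p \<le> 1" for f g p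
    by (auto simp: \<delta>'_def \<delta>_def min_le_iff_disj split: option.splits)
  have bdd: "bdd_above (\<delta>' f g ` I)" for f g
    by (rule bdd_aboveI[of _ 1]) (use bound in auto)
  have upper: "min (1 / Suc n) \<bar>f x - g x\<bar> \<le> d f g" if "x \<in> k n" for f g n x
  proof -
    have "\<delta>' f g (Some (n,x)) \<le> d f g"
      unfolding d_def by (rule cSUP_upper[OF _ bdd]) (use that in \<open>auto simp: I_def\<close>)
    then show ?thesis by (simp add: \<delta>'_def \<delta>_def)
  qed
  have least: "d f g \<le> c" if "c \<ge> 0"
    "\<And>n x. x \<in> k n \<Longrightarrow> min (1 / Suc n) \<bar>f x - g x\<bar> \<le> c" for f g c
    unfolding d_def by (rule cSUP_least) (use that in \<open>auto simp: I_def \<delta>'_def \<delta>_def\<close>)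
  have nonneg: "0 \<le> d f g" for f g
  proof -
    have "\<delta>' f g None \<le> d f g"
      unfolding d_def by (rule cSUP_upper[OF _ bdd]) (auto simp: I_def)
    then show ?thesis by (simp add: \<delta>'_def)
  qed
  interpret Metric_space M d
  proof
    show "0 \<le> d f g" for f g by (rule nonneg)
    have "\<delta>' f g = \<delta>' g f" for f g
      by (auto simp: \<delta>'_def \<delta>_def abs_minus_commute split: option.splits)
    then show "d f g = d g f" for f g
      unfolding d_def by metis
    show "d f g = 0 \<longleftrightarrow> f = g" if "f \<in> M" "g \<in> M" for f g
    proof
      assume d0: "d f g = 0"
      show "f = g"
      proof (rule extensionalityI)
        show "f \<in> extensional (topspace X)" "g \<in> extensional (topspace X)"
          using that by (auto simp: M_def cont_real_functions_def)
        fix x assume "x \<in> topspace X"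
        then obtain n where "x \<in> k n" using \<K>(3) k(1) by blast
        then have "min (1 / Suc n) \<bar>f x - g x\<bar> \<le> 0" using upper d0 by metis
        then show "f x = g x" by (auto simp: min_def field_simps split: if_splits)
      qed
    next
      assume "f = g"
      then have "d f g \<le> 0" by (intro least) auto
      then show "d f g = 0" using nonneg[of f g] by linarith
    qed
    show "d f h \<le> d f g + d g h" for f g h
    proof (rule least)
      show "0 \<le> d f g + d g h" using nonneg[of f g] nonneg[of g h] by linarith
      fix n x assume x: "x \<in> k n"
      have "min (1 / Suc n) \<bar>f x - h x\<bar> \<le> min (1 / Suc n) \<bar>f x - g x\<bar> + min (1 / Suc n) \<bar>g x - h x\<bar>"
      proof -
        have "(0::real) < 1 / Suc n" by simp
        then show ?thesis unfolding min_def by (smt (verit))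
      qed
      then show "min (1 / Suc n) \<bar>f x - h x\<bar> \<le> d f g + d g h"
        using upper[OF x, of f g] upper[OF x, of g h] by linarith
    qed
  qed
  have "openin (Ck X) V" if V: "openin mtopology V" for V
  proof (subst openin_subopen, rule ballI)
    fix f assume fV: "f \<in> V"
    then obtain r where r: "r > 0" "mball f r \<subseteq> V"
      using V openin_mtopology by blast
    have f: "f \<in> cont_real_functions X"
      using fV V openin_mtopology M_def by blast
    \<comment> \<open>Beyond \<open>m\<close> the cap alone is below \<open>r / 2\<close>. Half of
      \<open>r\<close> is used because a supremum inherits only the non-strict bound.\<close>
    obtain m where m: "inverse (real (Suc m)) < r / 2"
      using reals_Archimedean[of "r/2"] r by auto
    have "compactin X (\<Union>(k ` {..m}))"
      by (rule compactin_Union) (use k in auto)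
    then obtain W where W: "openin (Ck X) W" "f \<in> W"
      "\<And>g x. g \<in> W \<Longrightarrow> x \<in> \<Union>(k ` {..m}) \<Longrightarrow> \<bar>f x - g x\<bar> < r/2"
      using Ck_uniform_nhd[OF f, of _ "r/2"] r by (metis half_gt_zero)
    have "W \<subseteq> mball f r"
    proof
      fix g assume g: "g \<in> W"
      then have gM: "g \<in> M"
        using openin_subset[OF W(1)] unfolding topspace_Ck M_def by blast
      have "d f g \<le> r / 2"
      proof (rule least)
        fix n x assume x: "x \<in> k n"
        show "min (1 / Suc n) \<bar>f x - g x\<bar> \<le> r / 2"
        proof (cases "n \<le> m")
          case True
          then have "\<bar>f x - g x\<bar> < r/2" using W(3)[OF g] x by blast
          then show ?thesis by linarith
        next
          case False
          then have "1 / real (Suc n) \<le> inverse (real (Suc m))"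
            by (simp add: field_simps)
          then show ?thesis using m by linarith
        qed
      qed (use r in simp)
      moreover have "f \<in> M" using f M_def by simp
      ultimately show "g \<in> mball f r" using r gM by simp
    qed
    then show "\<exists>T. openin (Ck X) T \<and> f \<in> T \<and> T \<subseteq> V"
      using W r by blast
  qed
  moreover have "openin mtopology V" if V: "openin (Ck X) V" for V
  proof -
    have "generate_topology_on
       {{f \<in> cont_real_functions X. f ` K \<subseteq> U} | K U. compactin X K \<and> open U} V"
      using V unfolding Ck_def openin_topology_generated_by_iff .
    then show ?thesis
    proof induction
      case (Basis s)
      then obtain K U where KU: "compactin X K" "open U"
        "s = {f \<in> cont_real_functions X. f ` K \<subseteq> U}" by blast
      obtain n where n: "K \<subseteq> k n" using KU(1) \<K>(4) k(1) by blast
      show ?case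
        unfolding openin_mtopology
      proof (intro conjI allI impI)
        show "s \<subseteq> M" using KU M_def by blast
        fix f assume fs: "f \<in> s"
        then have "compact (f ` K)" "f ` K \<subseteq> U"
          using KU image_compactin[OF KU(1), of euclideanreal f]
          by (auto simp: cont_real_functions_def)
        then obtain e where e: "e > 0" "(\<Union>x\<in>f ` K. cball x e) \<subseteq> U"
          using compact_subset_open_imp_cball_epsilon_subset KU(2) by blast
        \<comment> \<open>A radius of at most \<open>1 / Suc n\<close> prevents the minimum from
          being the cap, so on \<open>k n\<close> the metric bounds the difference itself.\<close>
        have "mball f (min e (1 / Suc n)) \<subseteq> s"
        proof
          fix g assume g: "g \<in> mball f (min e (1 / Suc n))"
          have "g x \<in> U" if x: "x \<in> K" for x
          proof -
            have "min (1 / Suc n) \<bar>f x - g x\<bar> < min e (1 / Suc n)"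
              using upper[of x n f g] x n g by fastforce
            then have "\<bar>f x - g x\<bar> < e" by (auto simp: min_def split: if_splits)
            then have "g x \<in> cball (f x) e" by (simp add: dist_real_def)
            then show ?thesis using e x by blast
          qed
          moreover have "g \<in> M" using g by simp
          ultimately show "g \<in> s" using KU by (auto simp: M_def)
        qed
        moreover have "0 < min e (1 / Suc n)" using e by simp
        ultimately show "\<exists>r>0. mball f r \<subseteq> s" by blast
      qed
    qed auto
  qed
  ultimately have "Ck X = mtopology"
    unfolding topology_eq by blast
  then show ?thesis
    using metrizable_space_mtopology by simp
qed

section \<open>Spaces that are not hemicompact\<close>

locale approximating_sequence =
  fixes X :: "'a topology" and N :: "nat \<Rightarrow> 'a set"
  assumes between: "\<And>K U. openin X U \<Longrightarrow> compactin X K \<Longrightarrow> K \<subseteq> U \<Longrightarrow> \<exists>i. K \<subseteq> N i \<and> N i \<subseteq> U"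
    and Int_closed: "\<And>i j. \<exists>k. N k = N i \<inter> N j"

lemma approximating_sequence_exists:
  assumes "countable \<N>" "k_network X \<N>"
  obtains N where "approximating_sequence X N"
proof -
  define \<A> where "\<A> = Union ` {\<F>. finite \<F> \<and> \<F> \<subseteq> \<N>}"
  \<comment> \<open>The empty subfamily puts the whole type into \<open>\<B>\<close>, so members may
    exceed \<open>topspace X\<close>.\<close>
  define \<B> where "\<B> = Inter ` {\<F>. finite \<F> \<and> \<F> \<subseteq> \<A>}"
  have cA: "countable \<A>"
    unfolding \<A>_def using assms countable_Collect_finite_subset by blast
  have "countable \<B>"
    unfolding \<B>_def using cA countable_Collect_finite_subset by blast
  moreover have "\<A> \<subseteq> \<B>"
  proof
    fix A assume "A \<in> \<A>"
    then have "A = \<Inter>{A}" "{A} \<in> {\<F>. finite \<F> \<and> \<F> \<subseteq> \<A>}" by auto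
    then show "A \<in> \<B>" unfolding \<B>_def by (rule image_eqI)
  qed
  moreover have "{} \<in> \<A>"
    unfolding \<A>_def by (rule image_eqI[of _ _ "{}"]) auto
  ultimately have r: "range (from_nat_into \<B>) = \<B>"
    using range_from_nat_into by (metis empty_iff in_mono)
  have "approximating_sequence X (from_nat_into \<B>)"
  proof
    fix K U assume "openin X U" "compactin X K" "K \<subseteq> U"
    then obtain \<F> where \<F>: "finite \<F>" "\<F> \<subseteq> \<N>" "K \<subseteq> \<Union>\<F>" "\<Union>\<F> \<subseteq> U"
      using assms(2) unfolding k_network_def by meson
    have "\<Union>\<F> \<in> \<A>"
      unfolding \<A>_def by (rule imageI) (use \<F> in simp)
    then have "\<Union>\<F> \<in> range (from_nat_into \<B>)"
      using \<open>\<A> \<subseteq> \<B>\<close> r by auto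
    then obtain i where "from_nat_into \<B> i = \<Union>\<F>" by (metis imageE)
    then show "\<exists>i. K \<subseteq> from_nat_into \<B> i \<and> from_nat_into \<B> i \<subseteq> U"
      using \<F> by (intro exI[of _ i]) simp
  next
    fix i j
    have "from_nat_into \<B> i \<in> \<B>" "from_nat_into \<B> j \<in> \<B>"
      using r by blast+
    then obtain \<F> \<G> where \<F>: "from_nat_into \<B> i = \<Inter>\<F>" "finite \<F>" "\<F> \<subseteq> \<A>"
      and \<G>: "from_nat_into \<B> j = \<Inter>\<G>" "finite \<G>" "\<G> \<subseteq> \<A>"
      unfolding \<B>_def by (elim imageE) simp
    have "\<Inter>(\<F> \<union> \<G>) \<in> \<B>"
      unfolding \<B>_def by (rule imageI) (use \<F> \<G> in simp)
    then have "\<Inter>(\<F> \<union> \<G>) \<in> range (from_nat_into \<B>)"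
      using r by simp
    then obtain k where "from_nat_into \<B> k = \<Inter>(\<F> \<union> \<G>)" by (metis imageE)
    then show "\<exists>k. from_nat_into \<B> k = from_nat_into \<B> i \<inter> from_nat_into \<B> j"
      using \<F> \<G> by (intro exI[of _ k]) (simp add: Inter_Un_distrib)
  qed
  then show ?thesis using that by blast
qed

context approximating_sequence
begin

lemma between_point:
  assumes "openin X U" "x \<in> U"
  obtains i where "x \<in> N i" "N i \<subseteq> U"
  using between[OF assms(1), of "{x}"] openin_subset[OF assms(1)] assms(2) by auto

text \<open>The sets \<open>N i\<close> that lie inside some member of the cover already cover
  \<open>X\<close>; one member is chosen for each. Together with regularity this yields normality,
  hence Urysohn functions.\<close>

lemma Lindelof: "Lindelof_space X"
  unfolding Lindelof_space_def
proof (intro allI impI)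
  fix \<U> assume \<U>: "(\<forall>U\<in>\<U>. openin X U) \<and> \<Union>\<U> = topspace X"
  define J where "J = {i. \<exists>U\<in>\<U>. N i \<subseteq> U}"
  obtain u where u: "\<And>i. i \<in> J \<Longrightarrow> u i \<in> \<U> \<and> N i \<subseteq> u i"
    using bchoice[of J "\<lambda>i U. U \<in> \<U> \<and> N i \<subseteq> U"] unfolding J_def by blast
  have "\<Union>(u ` J) = topspace X"
  proof
    show "\<Union>(u ` J) \<subseteq> topspace X" using u \<U> by blast
    show "topspace X \<subseteq> \<Union>(u ` J)"
    proof
      fix x assume "x \<in> topspace X"
      then obtain U where U: "U \<in> \<U>" "x \<in> U" using \<U> by blast
      then obtain i where i: "x \<in> N i" "N i \<subseteq> U" using \<U> between_point by blast
      then have "i \<in> J" using U J_def by blast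
      then show "x \<in> \<Union>(u ` J)" using u i by blast
    qed
  qed
  then show "\<exists>\<V>. countable \<V> \<and> \<V> \<subseteq> \<U> \<and> \<Union>\<V> = topspace X"
    using u by (intro exI[of _ "u ` J"]) auto
qed

text \<open>Compactness of \<open>K\<close> alone bounds \<open>C\<close> on \<open>K\<close>. The
  gain is a bound on some \<open>N i\<close>, a set that need not lie in any compact set.\<close>

lemma compactin_Ck_bounded_on_nhd:
  assumes C: "compactin (Ck X) C" and K: "compactin X K"
  obtains i m where "K \<subseteq> N i" "\<And>f x. f \<in> C \<Longrightarrow> x \<in> N i \<Longrightarrow> \<bar>f x\<bar> \<le> real m"
proof (rule ccontr)
  assume "\<not> thesis"
  then have nb: "\<exists>f\<in>C. \<exists>x\<in>N i. \<bar>f x\<bar> > real m" if "K \<subseteq> N i" for i m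
    using that \<open>\<And>i m. \<lbrakk>K \<subseteq> N i; \<And>f x. f \<in> C \<Longrightarrow> x \<in> N i \<Longrightarrow> \<bar>f x\<bar> \<le> real m\<rbrakk> \<Longrightarrow> thesis\<close>
    by (meson not_le)
  have KX: "K \<subseteq> topspace X" using K by (rule compactin_subset_topspace)
  \<comment> \<open>Intersecting the first \<open>n\<close> members that contain \<open>K\<close>
    yields sets eventually inside every open neighbourhood of \<open>K\<close>, which forces the
    points chosen from them to converge to \<open>K\<close>.\<close>
  have "\<exists>j. K \<subseteq> N j \<and> N j \<subseteq> topspace X \<and> (\<forall>i<n. K \<subseteq> N i \<longrightarrow> N j \<subseteq> N i)" for n
  proof (induction n)
    case 0
    then show ?case using between[OF openin_topspace K KX] by blast
  next
    case (Suc n)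
    then obtain j where j: "K \<subseteq> N j" "N j \<subseteq> topspace X" "\<forall>i<n. K \<subseteq> N i \<longrightarrow> N j \<subseteq> N i"
      by blast
    obtain j' where j': "N j' = N j \<inter> N n" using Int_closed by blast
    show ?case
    proof (cases "K \<subseteq> N n")
      case True
      with j j' show ?thesis by (intro exI[of _ j']) (auto simp: less_Suc_eq)
    next
      case False
      with j show ?thesis by (intro exI[of _ j]) (auto simp: less_Suc_eq)
    qed
  qed
  then obtain j where j: "\<And>n. K \<subseteq> N (j n)" "\<And>n. N (j n) \<subseteq> topspace X"
    "\<And>n i. i < n \<Longrightarrow> K \<subseteq> N i \<Longrightarrow> N (j n) \<subseteq> N i" by metis
  have "\<exists>f x. f \<in> C \<and> x \<in> N (j n) \<and> \<bar>f x\<bar> > real n" for n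
    using nb[OF j(1)] by blast
  then obtain f x where fx: "\<And>n. f n \<in> C" "\<And>n. x n \<in> N (j n)" "\<And>n. \<bar>f n (x n)\<bar> > real n"
    by metis
  have "compactin X (K \<union> range x)"
  proof (rule compactin_Un_range[OF K])
    show "x n \<in> topspace X" for n using fx(2) j(2) by blast
    fix U assume "openin X U" "K \<subseteq> U"
    then obtain i where i: "K \<subseteq> N i" "N i \<subseteq> U" using between K by blast
    have "x n \<in> U" if "n \<ge> Suc i" for n
      using j(3)[of i n] fx(2) that i by (meson Suc_le_lessD in_mono)
    then show "eventually (\<lambda>n. x n \<in> U) sequentially"
      unfolding eventually_sequentially by blast
  qed
  then obtain n :: nat where n: "\<And>g y. g \<in> C \<Longrightarrow> y \<in> K \<union> range x \<Longrightarrow> \<bar>g y\<bar> < n"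
    using compactin_Ck_uniformly_bounded[OF C] by blast
  show False using n[of "f n" "x n"] fx[of n] by auto
qed

end

section \<open>R-open sets\<close>

lemma R_open_eval_abs_greater:
  assumes "x \<in> topspace X"
  shows "R_open (Ck X) {f \<in> cont_real_functions X. \<bar>f x\<bar> > c}"
  unfolding R_open_def topspace_Ck
proof (intro conjI ballI)
  fix f assume "f \<in> {f \<in> cont_real_functions X. \<bar>f x\<bar> > c}"
  then have f: "\<bar>f x\<bar> > c" by auto
  \<comment> \<open>The affine rescaling takes the value \<open>c\<close> to 0 and
    \<open>\<bar>f x\<bar>\<close> to 1; the result is clamped to the unit interval.\<close>
  define \<phi> where "\<phi> = (\<lambda>g::'a\<Rightarrow>real. max 0 (min 1 ((\<bar>g x\<bar> - c) / (\<bar>f x\<bar> - c))))"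
  have "continuous_map (Ck X) euclideanreal \<phi>"
    unfolding \<phi>_def using f
    by (intro continuous_intros continuous_map_Ck_eval assms) auto
  then have "continuous_map (Ck X) (top_of_set {0..1}) \<phi>"
    by (auto simp: continuous_map_in_subtopology \<phi>_def)
  moreover have "\<phi> f = 1" using f by (simp add: \<phi>_def)
  moreover have "\<phi> g = 0" if "\<not> \<bar>g x\<bar> > c" for g
  proof -
    have "(\<bar>g x\<bar> - c) / (\<bar>f x\<bar> - c) \<le> 0"
      using f that by (intro divide_nonpos_pos) auto
    then show ?thesis by (simp add: \<phi>_def)
  qed
  ultimately show "\<exists>\<phi>. continuous_map (Ck X) (top_of_set {0..1::real}) \<phi> \<and> \<phi> f = 1 \<and>
      \<phi> ` (cont_real_functions X - {f \<in> cont_real_functions X. \<bar>f x\<bar> > c}) \<subseteq> {0}"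
    by (intro exI[of _ \<phi>]) auto
qed auto

lemma R_open_topspace: "R_open Y (topspace Y)"
  unfolding R_open_def by (auto intro!: exI[of _ "\<lambda>_. 1"])

lemma R_open_Int:
  assumes "R_open Y U" "R_open Y V"
  shows "R_open Y (U \<inter> V)"
  unfolding R_open_def
proof (intro conjI ballI)
  show "U \<inter> V \<subseteq> topspace Y" using assms unfolding R_open_def by blast
  fix y assume "y \<in> U \<inter> V"
  then obtain f g where
    f: "continuous_map Y (top_of_set {0..1::real}) f" "f y = 1" "f ` (topspace Y - U) \<subseteq> {0}" and
    g: "continuous_map Y (top_of_set {0..1::real}) g" "g y = 1" "g ` (topspace Y - V) \<subseteq> {0}"
    using assms unfolding R_open_def by (meson IntD1 IntD2)
  have fr: "continuous_map Y euclideanreal f" "\<And>z. z \<in> topspace Y \<Longrightarrow> 0 \<le> f z \<and> f z \<le> 1"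
    and gr: "continuous_map Y euclideanreal g" "\<And>z. z \<in> topspace Y \<Longrightarrow> 0 \<le> g z \<and> g z \<le> 1"
    using f(1) g(1) by (auto simp: continuous_map_in_subtopology)
  have "continuous_map Y euclideanreal (\<lambda>z. min (f z) (g z))"
    by (intro continuous_map_real_min fr gr)
  then have "continuous_map Y (top_of_set {0..1}) (\<lambda>z. min (f z) (g z))"
    using fr gr by (auto simp: continuous_map_in_subtopology min_le_iff_disj)
  moreover have "(\<lambda>z. min (f z) (g z)) ` (topspace Y - U \<inter> V) \<subseteq> {0}"
  proof (rule image_subsetI)
    fix z assume z: "z \<in> topspace Y - U \<inter> V"
    then have "f z = 0 \<or> g z = 0" using f(3) g(3) by blast
    then show "min (f z) (g z) \<in> {0}" using fr(2)[of z] gr(2)[of z] z by auto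
  qed
  ultimately show "\<exists>f. continuous_map Y (top_of_set {0..1::real}) f \<and> f y = 1 \<and>
      f ` (topspace Y - U \<inter> V) \<subseteq> {0}"
    using f g by (intro exI[of _ "\<lambda>z. min (f z) (g z)"]) auto
qed

text \<open>The factor \<open>topspace Y\<close> takes care of empty \<open>I\<close>, whose
  intersection is the whole type.\<close>

lemma R_open_finite_INT:
  assumes "finite I" "\<And>i. i \<in> I \<Longrightarrow> R_open Y (U i)"
  shows "R_open Y (topspace Y \<inter> (\<Inter>i\<in>I. U i))"
  using assms
proof (induction I rule: finite_induct)
  case (insert i I)
  then have "R_open Y (U i \<inter> (topspace Y \<inter> (\<Inter>i\<in>I. U i)))"
    by (intro R_open_Int insert.IH insert.prems) simp_all
  moreover have "U i \<inter> (topspace Y \<inter> (\<Inter>i\<in>I. U i)) = topspace Y \<inter> (\<Inter>i\<in>insert i I. U i)"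
    by blast
  ultimately show ?case by simp
qed (simp add: R_open_topspace)

lemma R_open_UN:
  assumes "\<And>i. i \<in> I \<Longrightarrow> R_open Y (U i)"
  shows "R_open Y (\<Union>i\<in>I. U i)"
  unfolding R_open_def
proof (intro conjI ballI)
  show "(\<Union>i\<in>I. U i) \<subseteq> topspace Y" using assms unfolding R_open_def by blast
  fix y assume "y \<in> (\<Union>i\<in>I. U i)"
  then obtain i where "i \<in> I" "y \<in> U i" by blast
  then obtain f where "continuous_map Y (top_of_set {0..1::real}) f" "f y = 1"
      "f ` (topspace Y - U i) \<subseteq> {0}"
    using assms unfolding R_open_def by meson
  then show "\<exists>f. continuous_map Y (top_of_set {0..1::real}) f \<and> f y = 1 \<and>
      f ` (topspace Y - (\<Union>i\<in>I. U i)) \<subseteq> {0}"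
    using \<open>i \<in> I\<close> by (intro exI[of _ f]) blast
qed

section \<open>A strong fan at the zero function\<close>

lemma not_hemicompact_imp_strong_Fin_fan:
  assumes X: "aleph0_space X" and nh: "\<not> hemicompact_space X"
  shows "\<exists>F. strong_Fin_fan (Ck X) F"
proof -
  obtain \<N> where "countable \<N>" "k_network X \<N>"
    using X unfolding aleph0_space_def by blast
  then obtain N where "approximating_sequence X N"
    using approximating_sequence_exists by blast
  then interpret approximating_sequence X N .
  have haus: "Hausdorff_space X"
    using X regular_t1_imp_Hausdorff_space unfolding aleph0_space_def by blast
  have normal: "normal_space X"
    using X Lindelof regular_Lindelof_imp_normal_space unfolding aleph0_space_def by blast

  define bad where "bad = (\<lambda>i. \<nexists>K. compactin X K \<and> N i \<inter> topspace X \<subseteq> K)"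
  \<comment> \<open>Otherwise each compact set lies in a member that is not bad, and the compact
    sets enclosing those members form a countable cofinal family.\<close>
  have "\<exists>K. compactin X K \<and> (\<forall>i. K \<subseteq> N i \<longrightarrow> bad i)"
  proof (rule ccontr)
    assume no: "\<not> ?thesis"
    have "\<forall>i. \<exists>K. \<not> bad i \<longrightarrow> compactin X K \<and> N i \<inter> topspace X \<subseteq> K"
      unfolding bad_def by blast
    then obtain k where k: "\<And>i. \<not> bad i \<Longrightarrow> compactin X (k i) \<and> N i \<inter> topspace X \<subseteq> k i"
      by metis
    have cof: "\<exists>L\<in>k ` {i. \<not> bad i}. C \<subseteq> L" if C: "compactin X C" for C
    proof -
      obtain i where "C \<subseteq> N i" "\<not> bad i" using no C by blast
      then show ?thesis using k[of i] compactin_subset_topspace[OF C] by blast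
    qed
    have "\<Union>(k ` {i. \<not> bad i}) = topspace X"
    proof
      show "\<Union>(k ` {i. \<not> bad i}) \<subseteq> topspace X"
        using k compactin_subset_topspace by blast
      show "topspace X \<subseteq> \<Union>(k ` {i. \<not> bad i})"
      proof
        fix x assume "x \<in> topspace X"
        then show "x \<in> \<Union>(k ` {i. \<not> bad i})" using cof[of "{x}"] by auto
      qed
    qed
    then have "hemicompact_space X"
      unfolding hemicompact_space_def using cof k
      by (intro exI[of _ "k ` {i. \<not> bad i}"]) auto
    then show False using nh by blast
  qed
  then obtain K\<^sub>0 where K0: "compactin X K\<^sub>0" "\<And>i. K\<^sub>0 \<subseteq> N i \<Longrightarrow> bad i" by blast

  have ncomp: "\<not> compactin X (topspace X)"
  proof
    assume "compactin X (topspace X)"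
    then have "hemicompact_space X"
      unfolding hemicompact_space_def using compactin_subset_topspace
      by (intro exI[of _ "{topspace X}"]) auto
    then show False using nh by blast
  qed
  then have "topspace X \<noteq> {}" by (metis compactin_empty)
  then obtain x\<^sub>0 where x0: "x\<^sub>0 \<in> topspace X" by blast
  \<comment> \<open>A dense sequence, in which each \<open>N i\<close> is visited infinitely often.\<close>
  define x where "x = (\<lambda>n. let i = fst (prod_decode n) in
     if N i \<inter> topspace X = {} then x\<^sub>0 else SOME y. y \<in> N i \<inter> topspace X)"
  have xX: "x n \<in> topspace X" for n
    unfolding x_def Let_def using x0 some_in_eq[of "N (fst (prod_decode n)) \<inter> topspace X"] by auto
  \<comment> \<open>The open complement of \<open>K\<close> is nonempty and contains a nonempty
    \<open>N i\<close>; the sequence visits it at the code of \<open>(i, m)\<close>, which is at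
    least \<open>m\<close>.\<close>
  have x_out: "\<exists>n\<ge>m. x n \<notin> K" if K: "compactin X K" for K m
  proof -
    have op: "openin X (topspace X - K)"
      using K haus compactin_imp_closedin by blast
    have "topspace X - K \<noteq> {}"
      using K ncomp compactin_subset_topspace by (metis Diff_eq_empty_iff subset_antisym)
    then obtain y where y: "y \<in> topspace X - K" by blast
    obtain i where i: "y \<in> N i" "N i \<subseteq> topspace X - K" by (rule between_point[OF op y])
    have "x (prod_encode (i, m)) \<in> N i"
      unfolding x_def Let_def using i y some_in_eq[of "N i \<inter> topspace X"] by auto
    then show ?thesis using i le_prod_encode_2 by blast
  qed

  \<comment> \<open>Only the finitely many bad \<open>i \<le> a\<close> enter, so
    \<open>G a b\<close> is a finite intersection of R-open sets. The union over \<open>p\<close>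
    expresses largeness somewhere on \<open>N i\<close>.\<close>
  define G where "G = (\<lambda>a b. {f \<in> cont_real_functions X. \<bar>f (x a)\<bar> > real b} \<inter>
     (topspace (Ck X) \<inter> (\<Inter>i\<in>{i. i \<le> a \<and> bad i}. \<Union>p\<in>N i \<inter> topspace X.
        {f \<in> cont_real_functions X. \<bar>f p\<bar> > real a})))"
  have G_R: "R_open (Ck X) (G a b)" for a b
    unfolding G_def
    by (intro R_open_Int R_open_finite_INT R_open_UN R_open_eval_abs_greater xX) auto
  \<comment> \<open>Here \<open>b\<close> plays two roles, as the threshold at \<open>x a\<close>
    and as the index of a zero set. This lets countably many functions reach every neighbourhood of
    0.\<close>
  define vanishing where "vanishing = (\<lambda>a b. {f \<in> G a b. \<forall>y\<in>N b. f y = 0})"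
  define U where "U = (\<lambda>n. case_prod G (prod_decode n))"
  define F where "F = (\<lambda>n. case prod_decode n of (a,b) \<Rightarrow>
     if vanishing a b = {} then {} else {SOME f. f \<in> vanishing a b})"
  have F_van: "F n \<subseteq> case_prod vanishing (prod_decode n)" for n
    unfolding F_def by (auto split: prod.splits simp: some_in_eq)
  have FU: "F n \<subseteq> U n" for n
    using F_van[of n] unfolding U_def vanishing_def by (auto split: prod.splits)

  have cf: "compact_finite_family (Ck X) U"
    unfolding compact_finite_family_def
  proof (intro allI impI)
    fix C assume C: "compactin (Ck X) C"
    obtain i m where im: "K\<^sub>0 \<subseteq> N i" "\<And>f x. f \<in> C \<Longrightarrow> x \<in> N i \<Longrightarrow> \<bar>f x\<bar> \<le> real m"
      using compactin_Ck_bounded_on_nhd[OF C K0(1)] by blast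
    have "bad i" using K0 im by blast
    have "\<exists>B::nat. \<forall>f\<in>C. \<bar>f (x a)\<bar> < B" for a
      using compactin_Ck_uniformly_bounded[OF C, of "{x a}"] xX by (metis compactin_sing singletonI)
    then obtain B :: "nat \<Rightarrow> nat" where B: "\<And>a f. f \<in> C \<Longrightarrow> \<bar>f (x a)\<bar> < B a" by metis
    \<comment> \<open>If \<open>a\<close> were at least \<open>i\<close> and \<open>m\<close>, then
      \<open>f\<close> would exceed \<open>a \<ge> m\<close> somewhere on the bad
      \<open>N i\<close>, against \<open>im\<close>. The bound on \<open>b\<close> depends on
      \<open>a\<close>, but only finitely many \<open>a\<close> remain.\<close>
    have ab: "a < max i m \<and> b < B a" if f: "f \<in> G a b" "f \<in> C" for a b f
    proof
      show "a < max i m"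
      proof (rule ccontr)
        assume "\<not> a < max i m"
        then have "i \<le> a" "m \<le> a" by auto
        then obtain p where "p \<in> N i" "\<bar>f p\<bar> > real a"
          using f(1) \<open>bad i\<close> unfolding G_def by blast
        then show False using im(2)[OF f(2)] \<open>m \<le> a\<close> by fastforce
      qed
      have "\<bar>f (x a)\<bar> > real b" using f unfolding G_def by blast
      then show "b < B a" using B[OF f(2), of a] by linarith
    qed
    have "{n. U n \<inter> C \<noteq> {}} \<subseteq> prod_encode ` (SIGMA a:{..<max i m}. {..<B a})"
    proof
      fix n assume "n \<in> {n. U n \<inter> C \<noteq> {}}"
      then obtain f where f: "f \<in> U n" "f \<in> C" by blast
      obtain a b where n: "prod_decode n = (a, b)" by (cases "prod_decode n")
      then have "(a, b) \<in> (SIGMA a:{..<max i m}. {..<B a})"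
        using ab[of f a b] f unfolding U_def by simp
      moreover have "n = prod_encode (a, b)" using n by (metis prod_decode_inverse)
      ultimately show "n \<in> prod_encode ` (SIGMA a:{..<max i m}. {..<B a})" by blast
    qed
    then show "finite {n. U n \<inter> C \<noteq> {}}"
      by (rule finite_subset) auto
  qed

  have "\<not> locally_finite_family (Ck X) F"
  proof
    let ?z = "restrict (\<lambda>_. 0::real) (topspace X)"
    assume lf: "locally_finite_family (Ck X) F"
    have "?z \<in> topspace (Ck X)"
      unfolding topspace_Ck by (intro restrict_in_cont_real_functions) simp
    then obtain V where V: "openin (Ck X) V" "?z \<in> V" "finite {n. F n \<inter> V \<noteq> {}}"
      using lf unfolding locally_finite_family_def by blast
    obtain K where K: "compactin X K"
      "\<And>g. g \<in> cont_real_functions X \<Longrightarrow> (\<And>x. x \<in> K \<Longrightarrow> g x = 0) \<Longrightarrow> g \<in> V"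
      using Ck_nhd_of_zero[OF V(1,2)] by blast
    have "\<exists>n\<ge>m. F n \<inter> V \<noteq> {}" for m
    proof -
      \<comment> \<open>The code of \<open>(a, b)\<close> is at least \<open>a\<close>, so
        \<open>a \<ge> m\<close> makes the index large whatever \<open>b\<close> turns out to
        be.\<close>
      obtain a where a: "a \<ge> m" "x a \<notin> K" using x_out K(1) by blast
      have "\<exists>p. p \<in> N i \<inter> topspace X - K" if "bad i" for i
        using that K(1) unfolding bad_def by blast
      then obtain p where p: "\<And>i. bad i \<Longrightarrow> p i \<in> N i \<inter> topspace X - K" by metis
      define S where "S = insert (x a) (p ` {i. i \<le> a \<and> bad i})"
      have "finite S" "S \<subseteq> topspace X" "disjnt K S"
        unfolding S_def disjnt_def using a xX p by auto
      then have "closedin X S" using haus closedin_Hausdorff_finite by blast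
      moreover have "closedin X K" using K(1) haus compactin_imp_closedin by blast
      ultimately obtain f where f: "continuous_map X euclideanreal f" "f ` K \<subseteq> {0}" "f ` S \<subseteq> {1}"
        using Urysohn_lemma_alt[OF normal] \<open>disjnt K S\<close> by metis
      \<comment> \<open>\<open>f\<close> is known to vanish only on \<open>K\<close>, while
        \<open>N b\<close> may be larger. Keeping \<open>N b\<close> where \<open>f\<close> is below
        1/2 and truncating \<open>2 * f - 1\<close> at 0 makes \<open>g\<close> vanish on all of
        \<open>N b\<close>.\<close>
      define W where "W = {y \<in> topspace X. f y \<in> {..<1/2}}"
      have "openin X W" unfolding W_def
        by (rule openin_continuous_map_preimage[OF f(1)]) auto
      moreover have "K \<subseteq> W" unfolding W_def
        using f compactin_subset_topspace[OF K(1)] by auto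
      ultimately obtain b where b: "K \<subseteq> N b" "N b \<subseteq> W" using between K(1) by blast
      \<comment> \<open>\<open>b\<close> is obtained from \<open>f\<close> before scaling, so the
        factor may depend on it; it exceeds both thresholds \<open>a\<close> and
        \<open>b\<close>.\<close>
      define g where "g = restrict (\<lambda>y. (real a + real b + 1) * max 0 (2 * f y - 1)) (topspace X)"
      have gc: "g \<in> cont_real_functions X"
        unfolding g_def
        by (intro restrict_in_cont_real_functions continuous_intros f)
      have gS: "g y = real a + real b + 1" if "y \<in> S" for y
      proof -
        have "f y = 1" using f(3) that by blast
        then show ?thesis unfolding g_def using that \<open>S \<subseteq> topspace X\<close> by auto
      qed
      have "g \<in> G a b"
      proof -
        have "\<exists>q\<in>N i \<inter> topspace X. \<bar>g q\<bar> > real a" if "i \<le> a" "bad i" for i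
        proof -
          have "p i \<in> S" using that S_def by blast
          then show ?thesis using gS[of "p i"] p[OF that(2)] by (intro bexI[of _ "p i"]) auto
        qed
        moreover have "\<bar>g (x a)\<bar> > real b" using gS[of "x a"] S_def by simp
        ultimately show ?thesis unfolding G_def topspace_Ck using gc by auto
      qed
      moreover have "g y = 0" if "y \<in> N b" for y
        using that b unfolding W_def g_def by (auto simp: max_def)
      ultimately have "g \<in> vanishing a b" unfolding vanishing_def by blast
      then have ne: "vanishing a b \<noteq> {}" by blast
      \<comment> \<open>The fan contains the chosen \<open>h\<close>, not necessarily
        \<open>g\<close>; every element of \<open>vanishing a b\<close> is zero on
        \<open>N b\<close>, hence on \<open>K\<close>, so \<open>h\<close> lies in \<open>V\<close>
        as well.\<close>
      define h where "h = (SOME f. f \<in> vanishing a b)"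
      have h: "h \<in> vanishing a b" unfolding h_def using ne by (simp add: some_in_eq)
      then have "h \<in> V"
        by (intro K(2)) (use b in \<open>auto simp: vanishing_def G_def\<close>)
      moreover have "h \<in> F (prod_encode (a, b))"
        unfolding F_def using ne by (simp add: h_def)
      ultimately show ?thesis
        using le_prod_encode_1[of a b] a(1) by (metis IntI empty_iff le_trans)
    qed
    then have "infinite {n. F n \<inter> V \<noteq> {}}"
      unfolding infinite_nat_iff_unbounded_le by blast
    then show False using V(3) by blast
  qed
  moreover have "compact_finite_family (Ck X) F"
    unfolding compact_finite_family_def
  proof (intro allI impI)
    fix C assume "compactin (Ck X) C"
    then have "finite {n. U n \<inter> C \<noteq> {}}" using cf unfolding compact_finite_family_def by blast
    then show "finite {n. F n \<inter> C \<noteq> {}}" by (rule rev_finite_subset) (use FU in blast)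
  qed
  moreover have "finite (F n)" for n
    unfolding F_def by (auto split: prod.splits)
  moreover have UR: "R_open (Ck X) (U n)" for n
    unfolding U_def using G_R by (auto split: prod.splits)
  moreover have "F n \<subseteq> topspace (Ck X)" for n
    using FU[of n] UR[of n] unfolding R_open_def by blast
  ultimately have "strong_Fin_fan (Ck X) F"
    unfolding strong_Fin_fan_def Fin_fan_def using cf FU by blast
  then show ?thesis by blast
qed

theorem theorem1p9:
  fixes X :: "'a topology"
  assumes "aleph0_space X"
  shows "(metrizable_space (Ck X) \<longleftrightarrow> \<not> (\<exists>F. strong_Fin_fan (Ck X) F)) \<and>
         (\<not> (\<exists>F. strong_Fin_fan (Ck X) F) \<longleftrightarrow> hemicompact_space X)"
proof -
  have "\<not> (\<exists>F. strong_Fin_fan (Ck X) F)" if "metrizable_space (Ck X)"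
    using that metrizable_compact_finite_imp_locally_finite
    unfolding strong_Fin_fan_def Fin_fan_def by blast
  \<comment> \<open>The three implications close a cycle, which gives both equivalences.\<close>
  then show ?thesis
    using not_hemicompact_imp_strong_Fin_fan[OF assms] hemicompact_imp_metrizable_Ck by blast
qed

end
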